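(* Let $DB$ be an uncertain sequence database with item weights $w$. For every sequential pattern $\alpha$ (of any length $m\ge1$), $$wExpSup^{cap}(\alpha)\ \ge\ WES(\alpha).$$
   Context: Fix a finite, totally ordered (lexicographic) set of items $I$, each item $i$ having a weight $w(i)\in[0,1]$. A sequential pattern is a finite sequence $\alpha=\langle X_1,\dots,X_r\rangle$ of nonempty subsets of $I$ (itemsets, or events), each written in increasing item order; its length is $m=\sum_j|X_j|$. Listing the items of $\alpha$ in order as $i_1,\dots,i_m$, let $\alpha_k$ be the pattern formed by the first $k$ items ($\alpha_0$ empty). Thus $\alpha_k$ arises from $\alpha_{k-1}$ either by s-extension ($i_k$ is appended as a new event $\{i_k\}$) or by i-extension ($i_k$ is added to the last event of $\alpha_{k-1}$). An uncertain sequence is a finite sequence of itemsets $S=\langle e_1,\dots,e_n\rangle$ in which every item occurrence carries an existential probability in $(0,1]$. An uncertain sequence database $DB$ is a finite list of uncertain sequences. An occurrence of $\alpha$ in $S$ is a choice of indices $j_1<\dots<j_r$ with $X_l\subseteq e_{j_l}$ for all $l$; its probability is the product of the existential probabilities of the $m$ item occurrences used. $maxPr_S(\alpha)$ is the maximum of these probabilities over all occurrences of $\alpha$ in $S$ ($0$ if there are none), and $expSup(\alpha)=\sum_{S\in DB}maxPr_S(\alpha)$. Projected database: for a pattern $\beta$ with last event $X$, $DB|\beta$ consists, for each $S\in DB$ containing $\beta$, of the suffix of $S$ after the leftmost match of $\beta$: with $t$ minimal such that $\beta$ occurs in $\langle e_1,\dots,e_t\rangle$, the suffix consists of the items of $e_t$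 that follow the last item of $\beta$, and the events $e_{t+1},\dots,e_n$ (with their probabilities). $DB|\alpha_0=DB$. An occurrence of an item $i$ in such a suffix is counted as an s-extension of $\beta$ if it lies in one of $e_{t+1},\dots,e_n$, and as an i-extension of $\beta$ if it lies in the remaining part of $e_t$, or in an event $e_j$, $j>t$, with $X\cup\{i\}\subseteq e_j$. When an item $i_k$ is considered in $DB|\alpha_{k-1}$, only occurrences of the extension type by which $\alpha_k$ arises from $\alpha_{k-1}$ are counted. $\widehat P_{DB|\alpha_{k-1}}(i_k)$ is the maximum probability of a counted occurrence of $i_k$ in $DB|\alpha_{k-1}$ ($0$ if none), and for $S\in DB|\alpha_{m-1}$, $maxPr_S(i_m)$ is the maximum probability of a counted occurrence of $i_m$ in that suffix ($0$ if none). Define $$maxPr(\alpha_k)=\prod_{l=1}^{k}\widehat P_{DB|\alpha_{l-1}}(i_l)\quad(maxPr(\alpha_0)=1),\qquad expSup^{cap}(\alpha)=maxPr(\alpha_{m-1})\times\sum_{S\in DB|\alpha_{m-1}}maxPr_S(i_m).$$ Weights: $sWeight(\alpha)=\frac1m\sum_{k=1}^m w(i_k)$; $mxW_{DB}(DB|\beta)$ is the maximum weight of an item occurring in $DB|\beta$ ($0$ if there is none); $mxW_s(\alpha)=\max_k w(i_k)$; $wgt^{cap}(\alpha)=\max\big(mxW_{DB}(DB|\alpha_{m-1}),mxW_s(\alpha)\big)$. Finally $WES(\alpha)=expSup(\alpha)\times sWeight(\alpha)$ (weighted expected support) and $wExpSup^{cap}(\alpha)=expSup^{cap}(\alpha)\times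 wgt^{cap}(\alpha)$. *)

theory Defs
  imports Complex_Main
begin

definition max0 :: "real set \<Rightarrow> real" where
  "max0 A = (if A = {} then 0 else Max A)"


section \<open>Sequential patterns\<close>

type_synonym 'i pattern = "'i set list"

definition is_pattern :: "'i set \<Rightarrow> 'i pattern \<Rightarrow> bool" where
  "is_pattern I \<alpha> \<longleftrightarrow> (\<forall>X\<in>set \<alpha>. X \<noteq> {} \<and> X \<subseteq> I)"

definition pat_length :: "'i pattern \<Rightarrow> nat" where
  "pat_length \<alpha> = (\<Sum>X\<leftarrow>\<alpha>. card X)"

text \<open>Items are numbered from 1, as in \<open>i\<^sub>1, \<dots>, i\<^sub>m\<close>.\<close>

definition item :: "('i::linorder) pattern \<Rightarrow> nat \<Rightarrow> 'i" where
  "item \<alpha> k = concat (map sorted_list_of_set \<alpha>) ! (k - 1)"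

text \<open>\<open>pat_prefix k \<alpha>\<close> is the pattern \<open>\<alpha>\<^sub>k\<close> formed by the first \<open>k\<close> items of \<open>\<alpha>\<close>; its last event
  may be a proper initial part of an event of \<open>\<alpha>\<close>.\<close>

fun pat_prefix :: "nat \<Rightarrow> ('i::linorder) pattern \<Rightarrow> 'i pattern" where
  "pat_prefix k [] = []"
| "pat_prefix k (X # \<alpha>) =
     (if k = 0 then []
      else if k < card X then [set (take k (sorted_list_of_set X))]
      else X # pat_prefix (k - card X) \<alpha>)"

datatype ext = S_ext | I_ext

text \<open>The type of the extension leading from \<open>\<alpha>\<^sub>k\<^sub>-\<^sub>1\<close> to \<open>\<alpha>\<^sub>k\<close> (\<open>1 \<le> k \<le> m\<close>): either \<open>i\<^sub>k\<close> is appended as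
  a new event, or it is added to the last event of \<open>\<alpha>\<^sub>k\<^sub>-\<^sub>1\<close>.\<close>

definition ext_type :: "('i::linorder) pattern \<Rightarrow> nat \<Rightarrow> ext" where
  "ext_type \<alpha> k =
     (if pat_prefix k \<alpha> = pat_prefix (k - 1) \<alpha> @ [{item \<alpha> k}] then S_ext else I_ext)"


section \<open>Uncertain sequences\<close>

text \<open>An uncertain event maps each of its items to its existential probability; the underlying
  itemset is the domain of the map.\<close>

type_synonym 'i uevent = "'i \<rightharpoonup> real"
type_synonym 'i useq = "'i uevent list"
type_synonym 'i udb = "'i useq list"

definition is_uevent :: "'i set \<Rightarrow> 'i uevent \<Rightarrow> bool" where
  "is_uevent I e \<longleftrightarrow> dom e \<noteq> {} \<and> dom e \<subseteq> I \<and> ran e \<subseteq> {0<..1}"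

definition is_udb :: "'i set \<Rightarrow> 'i udb \<Rightarrow> bool" where
  "is_udb I DB \<longleftrightarrow> (\<forall>S\<in>set DB. \<forall>e\<in>set S. is_uevent I e)"

text \<open>Event indices are numbered from 0.\<close>

definition occurrences :: "'i pattern \<Rightarrow> 'i useq \<Rightarrow> nat list set" where
  "occurrences \<alpha> S =
     {js. length js = length \<alpha> \<and> sorted_wrt (<) js \<and>
          (\<forall>l<length \<alpha>. js ! l < length S \<and> \<alpha> ! l \<subseteq> dom (S ! (js ! l)))}"

definition occ_prob :: "'i pattern \<Rightarrow> 'i useq \<Rightarrow> nat list \<Rightarrow> real" where
  "occ_prob \<alpha> S js = (\<Prod>l<length \<alpha>. \<Prod>i\<in>\<alpha> ! l. the ((S ! (js ! l)) i))"

definition maxPr_seq :: "'i useq \<Rightarrow> 'i pattern \<Rightarrow> real" where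
  "maxPr_seq S \<alpha> = max0 (occ_prob \<alpha> S ` occurrences \<alpha> S)"

definition expSup :: "'i udb \<Rightarrow> 'i pattern \<Rightarrow> real" where
  "expSup DB \<alpha> = (\<Sum>S\<leftarrow>DB. maxPr_seq S \<alpha>)"


section \<open>Projected databases\<close>

definition contains :: "'i useq \<Rightarrow> 'i pattern \<Rightarrow> bool" where
  "contains S \<beta> \<longleftrightarrow> occurrences \<beta> S \<noteq> {}"

text \<open>The number \<open>t\<close> of events in the shortest initial segment of \<open>S\<close> containing \<open>\<beta>\<close>; the leftmost
  match thus ends in the event \<open>S ! (t - 1)\<close>, and \<open>t = 0\<close> for the empty pattern.\<close>

definition match_end :: "'i pattern \<Rightarrow> 'i useq \<Rightarrow> nat" where
  "match_end \<beta> S = (LEAST t. contains (take t S) \<beta>)"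

text \<open>A suffix consists of the remaining part of the event in which the leftmost match ends, and of
  the later events. For the empty pattern there is no such event and the remaining part is empty,
  so the suffix is the whole sequence.\<close>

type_synonym 'i suffix = "'i uevent \<times> 'i useq"

definition project :: "('i::linorder) pattern \<Rightarrow> 'i useq \<Rightarrow> 'i suffix" where
  "project \<beta> S =
     (let t = match_end \<beta> S in
      (if \<beta> = [] then Map.empty else (S ! (t - 1)) |` {i. Max (last \<beta>) < i}, drop t S))"

definition proj_db :: "('i::linorder) udb \<Rightarrow> 'i pattern \<Rightarrow> 'i suffix list" where
  "proj_db DB \<beta> = map (project \<beta>) (filter (\<lambda>S. contains S \<beta>) DB)"

text \<open>The probabilities of the occurrences of \<open>i\<close> in a suffix w.r.t. \<open>\<beta>\<close> that count for the given
  extension type.\<close>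

fun counted :: "'i pattern \<Rightarrow> ext \<Rightarrow> 'i \<Rightarrow> 'i suffix \<Rightarrow> real set" where
  "counted \<beta> S_ext i (r, es) = {p. \<exists>e\<in>set es. e i = Some p}"
| "counted \<beta> I_ext i (r, es) =
     {p. r i = Some p \<or> (\<exists>e\<in>set es. last \<beta> \<union> {i} \<subseteq> dom e \<and> e i = Some p)}"

definition maxPr_suffix :: "'i pattern \<Rightarrow> ext \<Rightarrow> 'i \<Rightarrow> 'i suffix \<Rightarrow> real" where
  "maxPr_suffix \<beta> x i s = max0 (counted \<beta> x i s)"

definition Phat :: "('i::linorder) udb \<Rightarrow> 'i pattern \<Rightarrow> ext \<Rightarrow> 'i \<Rightarrow> real" where
  "Phat DB \<beta> x i = max0 (\<Union>s\<in>set (proj_db DB \<beta>). counted \<beta> x i s)"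

text \<open>\<open>maxPr_prefix DB \<alpha> k\<close> is \<open>maxPr(\<alpha>\<^sub>k)\<close>.\<close>

definition maxPr_prefix :: "('i::linorder) udb \<Rightarrow> 'i pattern \<Rightarrow> nat \<Rightarrow> real" where
  "maxPr_prefix DB \<alpha> k =
     (\<Prod>l=1..k. Phat DB (pat_prefix (l - 1) \<alpha>) (ext_type \<alpha> l) (item \<alpha> l))"

definition expSup_cap :: "('i::linorder) udb \<Rightarrow> 'i pattern \<Rightarrow> real" where
  "expSup_cap DB \<alpha> =
     (let m = pat_length \<alpha>; \<beta> = pat_prefix (m - 1) \<alpha> in
      maxPr_prefix DB \<alpha> (m - 1) *
      (\<Sum>s\<leftarrow>proj_db DB \<beta>. maxPr_suffix \<beta> (ext_type \<alpha> m) (item \<alpha> m) s))"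


section \<open>Weights\<close>

definition sWeight :: "('i::linorder \<Rightarrow> real) \<Rightarrow> 'i pattern \<Rightarrow> real" where
  "sWeight w \<alpha> = (\<Sum>k=1..pat_length \<alpha>. w (item \<alpha> k)) / real (pat_length \<alpha>)"

definition suffix_items :: "'i suffix \<Rightarrow> 'i set" where
  "suffix_items s = dom (fst s) \<union> (\<Union>e\<in>set (snd s). dom e)"

definition mxW_DB :: "('i \<Rightarrow> real) \<Rightarrow> 'i suffix list \<Rightarrow> real" where
  "mxW_DB w D = max0 (w ` (\<Union>s\<in>set D. suffix_items s))"

definition mxW_s :: "('i::linorder \<Rightarrow> real) \<Rightarrow> 'i pattern \<Rightarrow> real" where
  "mxW_s w \<alpha> = (MAX k\<in>{1..pat_length \<alpha>}. w (item \<alpha> k))"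

definition wgt_cap :: "('i::linorder \<Rightarrow> real) \<Rightarrow> 'i udb \<Rightarrow> 'i pattern \<Rightarrow> real" where
  "wgt_cap w DB \<alpha> =
     max (mxW_DB w (proj_db DB (pat_prefix (pat_length \<alpha> - 1) \<alpha>))) (mxW_s w \<alpha>)"

definition WES :: "('i::linorder \<Rightarrow> real) \<Rightarrow> 'i udb \<Rightarrow> 'i pattern \<Rightarrow> real" where
  "WES w DB \<alpha> = expSup DB \<alpha> * sWeight w \<alpha>"

definition wExpSup_cap :: "('i::linorder \<Rightarrow> real) \<Rightarrow> 'i udb \<Rightarrow> 'i pattern \<Rightarrow> real" where
  "wExpSup_cap w DB \<alpha> = expSup_cap DB \<alpha> * wgt_cap w DB \<alpha>"

end

theory Submission
  imports Defs
begin

text \<open>Fix an occurrence of \<open>\<alpha>\<close> in \<open>S\<close>. The leftmost match of \<open>\<alpha>\<^sub>k\<^sub>-\<^sub>1\<close> ends no later than the matched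
  copy of \<open>\<alpha>\<^sub>k\<^sub>-\<^sub>1\<close>, so the matched occurrence of \<open>i\<^sub>k\<close> survives in the projected suffix and is counted
  for the extension type of \<open>i\<^sub>k\<close>. Each factor of the probability is thus at most the corresponding
  maximum, where the last one may be taken within \<open>S\<close> itself; summing over \<open>S\<close> bounds \<open>expSup\<close> by
  \<open>expSup\<^sup>c\<^sup>a\<^sup>p\<close>. The average weight is at most the maximal one.\<close>

lemma max0_ge: "finite A \<Longrightarrow> x \<in> A \<Longrightarrow> x \<le> max0 A"
  by (auto simp: max0_def)

lemma max0_le:
  assumes "finite A" "\<And>x. x \<in> A \<Longrightarrow> x \<le> b" "0 \<le> b"
  shows "max0 A \<le> b"
  using assms by (auto simp: max0_def)

lemma max0_nonneg:
  assumes "finite A" "\<And>x. x \<in> A \<Longrightarrow> 0 \<le> x"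
  shows "0 \<le> max0 A"
  using assms by (auto simp: max0_def)

section \<open>Enumerating the items of a pattern\<close>

text \<open>Index order and value order agree in a strictly increasing list, so initial segments are
  down-sets. This lets the truncated events of \<open>pat_prefix\<close> be described by comparison
  with a single item.\<close>

lemma set_take_strict_sorted:
  fixes xs :: "'a::linorder list"
  assumes "sorted_wrt (<) xs" "k < length xs"
  shows "set (take k xs) = {x \<in> set xs. x < xs ! k}"
    and "set (take (Suc k) xs) = {x \<in> set xs. x \<le> xs ! k}"
proof -
  have less_iff: "xs ! a < xs ! b \<longleftrightarrow> a < b" if "a < length xs" "b < length xs" for a b
    using sorted_wrt_nth_less[OF assms(1)] that by (metis less_asym linorder_neqE_nat less_irrefl)
  show less: "set (take k xs) = {x \<in> set xs. x < xs ! k}"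
  proof (intro set_eqI iffI)
    fix x assume "x \<in> set (take k xs)"
    then obtain a where "a < k" "x = xs ! a"
      using assms(2) by (auto simp: in_set_conv_nth)
    then show "x \<in> {x \<in> set xs. x < xs ! k}"
      using assms(2) less_iff[of a k] by simp
  next
    fix x assume "x \<in> {x \<in> set xs. x < xs ! k}"
    then obtain a where "a < length xs" "x = xs ! a" "xs ! a < xs ! k"
      by (auto simp: in_set_conv_nth)
    then show "x \<in> set (take k xs)"
      using assms(2) less_iff[of a k] by (auto simp: in_set_conv_nth)
  qed
  have "set (take (Suc k) xs) = insert (xs ! k) {x \<in> set xs. x < xs ! k}"
    using assms(2) by (simp add: take_Suc_conv_app_nth less)
  also have "\<dots> = {x \<in> set xs. x \<le> xs ! k}"
    using nth_mem[OF assms(2)] by (auto dest: order_le_imp_less_or_eq)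
  finally show "set (take (Suc k) xs) = {x \<in> set xs. x \<le> xs ! k}" .
qed

text \<open>The pair \<open>positions \<alpha> ! (k - 1)\<close> consists of the index of the event of \<open>\<alpha>\<close> containing \<open>i\<^sub>k\<close>, and of
  \<open>i\<^sub>k\<close> itself.\<close>

primrec positions :: "('i::linorder) pattern \<Rightarrow> (nat \<times> 'i) list" where
  "positions [] = []"
| "positions (X # \<alpha>) = map (Pair 0) (sorted_list_of_set X) @ map (apfst Suc) (positions \<alpha>)"

lemma length_positions: "length (positions \<alpha>) = pat_length \<alpha>"
  by (induction \<alpha>) (auto simp: pat_length_def)

lemma map_snd_positions: "map snd (positions \<alpha>) = concat (map sorted_list_of_set \<alpha>)"
  by (induction \<alpha>) (auto simp: comp_def)

lemma item_positions:
  assumes "k < pat_length \<alpha>"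
  shows "item \<alpha> (Suc k) = snd (positions \<alpha> ! k)"
  using assms by (simp add: item_def length_positions flip: map_snd_positions)

text \<open>Flattens the double product of \<open>occ_prob\<close> into one factor per item, to be
  compared with \<open>maxPr_prefix\<close> factor by factor. \<open>f\<close> stays arbitrary
  because the induction shifts event indices by one.\<close>

lemma prod_list_positions:
  fixes f :: "nat \<Rightarrow> 'i::linorder \<Rightarrow> real"
  assumes "\<forall>X\<in>set \<alpha>. finite X"
  shows "(\<Prod>l<length \<alpha>. \<Prod>i\<in>\<alpha> ! l. f l i) = prod_list (map (case_prod f) (positions \<alpha>))"
  using assms
proof (induction \<alpha> arbitrary: f)
  case (Cons X \<alpha>)
  have "(\<Prod>i\<in>X. f 0 i) = prod_list (map (f 0) (sorted_list_of_set X))"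
    using Cons.prems prod.distinct_set_conv_list[of "sorted_list_of_set X" "f 0"] by simp
  moreover have "case_prod f \<circ> apfst Suc = case_prod (\<lambda>l. f (Suc l))"
    by auto
  ultimately show ?case
    using Cons.IH[of "\<lambda>l. f (Suc l)"] Cons.prems
    by (simp add: prod.lessThan_Suc_shift comp_def del: prod.lessThan_Suc)
qed simp

text \<open>For \<open>i\<close> = \<open>i\<^sub>k\<close> in event \<open>l\<close>, this is
  \<open>\<alpha>\<^sub>k\<^sub>-\<^sub>1\<close>, described by order instead of by counting. An
  empty partial event is dropped, since patterns have nonempty events.\<close>

definition prefix_before :: "('i::linorder) pattern \<Rightarrow> nat \<Rightarrow> 'i \<Rightarrow> 'i pattern" where
  "prefix_before \<alpha> l i =
     take l \<alpha> @ (if \<exists>x\<in>\<alpha> ! l. x < i then [{x \<in> \<alpha> ! l. x < i}] else [])"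

lemma pat_prefix_0 [simp]: "pat_prefix 0 \<alpha> = []"
  by (cases \<alpha>) auto

text \<open>Induction over the events: position \<open>k\<close> lies in the first event, where
  \<open>set_take_strict_sorted\<close> applies, or is shifted by \<open>card X\<close> into the
  remaining ones.\<close>

lemma positions_pat_prefix:
  assumes "\<forall>X\<in>set \<alpha>. finite X \<and> X \<noteq> {}" "k < pat_length \<alpha>" "positions \<alpha> ! k = (l, i)"
  shows "l < length \<alpha> \<and> i \<in> \<alpha> ! l
    \<and> pat_prefix k \<alpha> = prefix_before \<alpha> l i
    \<and> pat_prefix (Suc k) \<alpha> = take l \<alpha> @ [{x \<in> \<alpha> ! l. x \<le> i}]"
  using assms
proof (induction \<alpha> arbitrary: k l)
  case Nil
  then show ?case by (simp add: pat_length_def)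
next
  case (Cons X \<alpha>)
  let ?xs = "sorted_list_of_set X"
  from Cons.prems have X: "finite X" "X \<noteq> {}" by auto
  then have "0 < card X" by (simp add: card_gt_0_iff)
  show ?case
  proof (cases "k < card X")
    case True
    then have l: "l = 0" and i: "i = ?xs ! k"
      using Cons.prems(3) by (auto simp: nth_append)
    have "i \<in> X"
      using True X i nth_mem[of k ?xs] by simp
    have "set (take k ?xs) = {x \<in> X. x < i}" "set (take (Suc k) ?xs) = {x \<in> X. x \<le> i}"
      using set_take_strict_sorted[of ?xs k] True X i by auto
    \<comment> \<open>When \<open>i\<close> is the last item of \<open>X\<close>,
      \<open>pat_prefix\<close> returns the event \<open>X\<close> itself rather than a truncated
      one.\<close>
    moreover have "set (take (Suc k) ?xs) = X" if "\<not> Suc k < card X"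
      using that X by simp
    \<comment> \<open>The partial event is absent exactly at \<open>k = 0\<close>, where
      \<open>pat_prefix\<close> is empty.\<close>
    moreover have "(\<exists>x\<in>X. x < i) \<longleftrightarrow> k \<noteq> 0"
    proof -
      have "(\<exists>x\<in>X. x < i) \<longleftrightarrow> set (take k ?xs) \<noteq> {}"
        using calculation(1) by auto
      then show ?thesis using \<open>0 < card X\<close> by (auto simp: X)
    qed
    ultimately show ?thesis
      using True \<open>i \<in> X\<close> by (auto simp: l prefix_before_def)
  next
    case False
    then obtain l' where l': "l = Suc l'" "positions \<alpha> ! (k - card X) = (l', i)"
      using Cons.prems by (auto simp: nth_append pat_length_def length_positions apfst_def map_prod_def
          split: prod.splits)
    have "k - card X < pat_length \<alpha>"
      using Cons.prems False by (auto simp: pat_length_def)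
    then show ?thesis
      using Cons.IH[of "k - card X" l'] Cons.prems(1) l' False \<open>0 < card X\<close>
      by (auto simp: prefix_before_def Suc_diff_le)
  qed
qed

text \<open>The least item of an event opens it. For any other item the prefix already ends in a
  nonempty part of the event, and appending a singleton would give one event too many.\<close>

lemma ext_type_positions:
  assumes "\<forall>X\<in>set \<alpha>. finite X \<and> X \<noteq> {}" "k < pat_length \<alpha>" "positions \<alpha> ! k = (l, i)"
  shows "ext_type \<alpha> (Suc k) = (if \<exists>x\<in>\<alpha> ! l. x < i then I_ext else S_ext)"
proof -
  note pp = positions_pat_prefix[OF assms]
  have "{x \<in> \<alpha> ! l. x \<le> i} = {i}" if "\<not> (\<exists>x\<in>\<alpha> ! l. x < i)"
    using that pp by force
  then show ?thesis
    using pp item_positions[OF assms(2)] assms(3)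
    by (auto simp: ext_type_def prefix_before_def)
qed

section \<open>Occurrences and leftmost matches\<close>

lemma finite_occurrences: "finite (occurrences \<alpha> S)"
proof (rule finite_subset)
  show "occurrences \<alpha> S \<subseteq> {js. set js \<subseteq> {..<length S} \<and> length js = length \<alpha>}"
    by (auto simp: occurrences_def in_set_conv_nth)
qed (simp add: finite_lists_length_eq)

lemma match_end_le: "contains (take t S) \<beta> \<Longrightarrow> match_end \<beta> S \<le> t"
  unfolding match_end_def by (rule Least_le)

lemma match_end_le_length: "contains S \<beta> \<Longrightarrow> match_end \<beta> S \<le> length S"
  by (rule match_end_le) simp

text \<open>As \<open>js\<close> is strictly increasing, the first \<open>l\<close> matches use only
  events before \<open>js ! l\<close>, which leaves that event whole for an s-extension.\<close>

lemma occurrences_take_event: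
  assumes "js \<in> occurrences \<alpha> S" "l < length \<alpha>"
  shows "take l js \<in> occurrences (take l \<alpha>) (take (js ! l) S)"
  using assms by (auto simp: occurrences_def sorted_wrt_take sorted_wrt_nth_less)

text \<open>For an i-extension, event \<open>js ! l\<close> has already been used to match
  \<open>Y\<close>, so it must be kept in the initial segment; hence \<open>Suc\<close>.\<close>

lemma occurrences_take_partial_event:
  assumes "js \<in> occurrences \<alpha> S" "l < length \<alpha>" "Y \<subseteq> \<alpha> ! l"
  shows "take (Suc l) js \<in> occurrences (take l \<alpha> @ [Y]) (take (Suc (js ! l)) S)"
proof -
  have "js ! a < Suc (js ! l)" if "a < Suc l" for a
    using that assms sorted_wrt_nth_less[of "(<)" js a l]
    by (cases "a = l") (auto simp: occurrences_def)
  moreover have "(take l \<alpha> @ [Y]) ! a \<subseteq> dom (S ! (js ! a))" if "a < Suc l" for a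
    using that assms by (cases "a = l") (auto simp: occurrences_def nth_append)
  moreover have "js ! a < length S" if "a < Suc l" for a
    using that assms by (simp add: occurrences_def)
  ultimately show ?thesis
    using assms by (simp add: occurrences_def sorted_wrt_take)
qed

lemma contains_of_take: "contains (take t S) \<beta> \<Longrightarrow> contains S \<beta>"
  by (auto simp: contains_def occurrences_def)

text \<open>If \<open>i\<close> is least in its event, the leftmost match of \<beta> ends before
  event \<open>js ! l\<close>, so that event lies in the suffix. Otherwise the match may also end in
  event \<open>js ! l\<close> itself, whose remaining part then contains \<open>i\<close>; if it
  ends earlier, the whole event is in the suffix and contains \<open>last \<beta>\<close> together
  with \<open>i\<close>.\<close>

lemma matched_item_counted:
  assumes js: "js \<in> occurrences \<alpha> S" and l: "l < length \<alpha>" and i: "i \<in> \<alpha> ! l"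
    and fin: "finite (\<alpha> ! l)"
  defines "\<beta> \<equiv> prefix_before \<alpha> l i"
    and "x \<equiv> if \<exists>x\<in>\<alpha> ! l. x < i then I_ext else S_ext"
  shows "contains S \<beta>" "the ((S ! (js ! l)) i) \<in> counted \<beta> x i (project \<beta> S)"
proof -
  let ?j = "js ! l" and ?t = "match_end \<beta> S" and ?Y = "{x \<in> \<alpha> ! l. x < i}"
  have j: "?j < length S" and dom: "\<alpha> ! l \<subseteq> dom (S ! ?j)"
    using js l by (auto simp: occurrences_def)
  obtain p where p: "(S ! ?j) i = Some p"
    using dom i by auto
  have later: "S ! ?j \<in> set (drop ?t S)" if "?t \<le> ?j"
    using that j nth_mem[of "?j - ?t" "drop ?t S"] by (simp add: diff_less_mono)
  have s_ext: "contains (take ?j S) \<beta>" if "\<not> (\<exists>x\<in>\<alpha> ! l. x < i)"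
    using that occurrences_take_event[OF js l]
    by (auto simp only: \<beta>_def prefix_before_def contains_def if_False append_Nil2)
  have i_ext: "contains (take (Suc ?j) S) \<beta>" if "\<exists>x\<in>\<alpha> ! l. x < i"
    using that occurrences_take_partial_event[OF js l, of ?Y]
    by (auto simp only: \<beta>_def prefix_before_def contains_def if_True)
  show "contains S \<beta>"
    using s_ext i_ext contains_of_take by blast
  show "the ((S ! ?j) i) \<in> counted \<beta> x i (project \<beta> S)"
  proof (cases "\<exists>x\<in>\<alpha> ! l. x < i")
    case False
    then have "?t \<le> ?j"
      by (intro match_end_le s_ext)
    then show ?thesis
      using False p later by (auto simp: x_def project_def Let_def)
  next
    case True
    then have \<beta>: "\<beta> = take l \<alpha> @ [?Y]"
      by (simp add: \<beta>_def prefix_before_def)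
    have "?t \<le> Suc ?j"
      using True by (intro match_end_le i_ext)
    \<comment> \<open>\<open>match_end\<close> counts events, so \<open>Suc ?j\<close> means that
      the match ends in event \<open>?j\<close>.\<close>
    then consider "?t \<le> ?j" | "?t = Suc ?j" by linarith
    then show ?thesis
    proof cases
      case 1
      then have "\<exists>e\<in>set (drop ?t S). last \<beta> \<union> {i} \<subseteq> dom e \<and> e i = Some p"
        using later p dom by (intro bexI[of _ "S ! ?j"]) (auto simp: \<beta>)
      then show ?thesis
        using True p by (simp add: x_def project_def Let_def)
    next
      case 2
      \<comment> \<open>This is the condition for \<open>i\<close> to survive the restriction made
        by \<open>project\<close>.\<close>
      have "Max ?Y < i"
        using True fin by (subst Max_less_iff) auto
      then show ?thesis
        using True p 2 by (simp add: x_def project_def Let_def \<beta>)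
    qed
  qed
qed

section \<open>Finiteness and signs of the counted probabilities\<close>

lemma counted_subset:
  "counted \<beta> x i (r, es) \<subseteq> the ` (\<lambda>e. e i) ` insert r (set es)"
  by (cases x) (force simp: image_iff)+

lemma finite_counted: "finite (counted \<beta> x i s)"
  using finite_subset[OF counted_subset[of \<beta> x i "fst s" "snd s"]] by simp

text \<open>Each counted probability is an entry of an actual event of \<open>S\<close>.
  Nonnegativity is what permits multiplying the factorwise bounds.\<close>

lemma counted_nonneg:
  assumes "is_udb I DB" "S \<in> set DB" "contains S \<beta>" "p \<in> counted \<beta> x i (project \<beta> S)"
  shows "0 \<le> p"
proof -
  have "\<exists>e\<in>set S. e i = Some p"
  proof (cases "\<exists>e\<in>set (snd (project \<beta> S)). e i = Some p")
    case True
    then show ?thesis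
      by (auto simp: project_def Let_def dest: in_set_dropD)
  next
    case False
    then have "fst (project \<beta> S) i = Some p"
      using assms(4) by (cases x; cases "project \<beta> S") auto
    then have "\<beta> \<noteq> []" and p: "(S ! (match_end \<beta> S - 1)) i = Some p"
      by (auto simp: project_def Let_def restrict_map_def split: if_splits)
    from \<open>\<beta> \<noteq> []\<close> assms(3) have "0 < length S"
      by (force simp: contains_def occurrences_def)
    then have "match_end \<beta> S - 1 < length S"
      using match_end_le_length[OF assms(3)] by linarith
    then show ?thesis using p by (metis nth_mem)
  qed
  then obtain e where "e \<in> set S" "p \<in> ran e"
    by (auto intro: ranI)
  then show ?thesis
    using assms(1,2) by (fastforce simp: is_udb_def is_uevent_def)
qed

lemma proj_db_cases:
  assumes "s \<in> set (proj_db DB \<beta>)"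
  obtains S where "S \<in> set DB" "contains S \<beta>" "s = project \<beta> S"
  using assms by (auto simp: proj_db_def)

lemma finite_Union_counted: "finite (\<Union>s\<in>set D. counted \<beta> x i s)"
  by (simp add: finite_counted)

lemma Phat_nonneg: "is_udb I DB \<Longrightarrow> 0 \<le> Phat DB \<beta> x i"
  unfolding Phat_def
  by (rule max0_nonneg[OF finite_Union_counted]) (auto elim!: proj_db_cases intro: counted_nonneg)

lemma maxPr_prefix_nonneg: "is_udb I DB \<Longrightarrow> 0 \<le> maxPr_prefix DB \<alpha> k"
  unfolding maxPr_prefix_def by (intro prod_nonneg) (auto intro: Phat_nonneg)

lemma maxPr_suffix_nonneg:
  assumes "is_udb I DB" "S \<in> set DB" "contains S \<beta>"
  shows "0 \<le> maxPr_suffix \<beta> x i (project \<beta> S)"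
  unfolding maxPr_suffix_def
  using counted_nonneg[OF assms] by (intro max0_nonneg[OF finite_counted])

lemma counted_le_Phat:
  assumes "S \<in> set DB" "contains S \<beta>" "p \<in> counted \<beta> x i (project \<beta> S)"
  shows "p \<le> Phat DB \<beta> x i"
  unfolding Phat_def
  using assms by (intro max0_ge[OF finite_Union_counted]) (auto simp: proj_db_def)

section \<open>Bounding the expected support\<close>

text \<open>The first \<open>n\<close> factors are bounded by maxima over the whole database, the
  last one by the maximum in \<open>S\<close> alone, so that summing over \<open>S\<close> gives
  \<open>expSup_cap\<close>.\<close>

lemma occ_prob_le:
  assumes "is_udb I DB" "S \<in> set DB" "\<forall>X\<in>set \<alpha>. finite X \<and> X \<noteq> {}" "pat_length \<alpha> = Suc n"
    and js: "js \<in> occurrences \<alpha> S"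
  defines "\<beta> \<equiv> pat_prefix n \<alpha>"
  shows "contains S \<beta>"
    and "occ_prob \<alpha> S js \<le> maxPr_prefix DB \<alpha> n *
      maxPr_suffix \<beta> (ext_type \<alpha> (Suc n)) (item \<alpha> (Suc n)) (project \<beta> S)"
proof -
  \<comment> \<open>The factor that item number \<open>k + 1\<close> contributes to the probability
    of \<open>js\<close>.\<close>
  define q where "q k = (case positions \<alpha> ! k of (l, i) \<Rightarrow> the ((S ! (js ! l)) i))" for k
  have step: "contains S (pat_prefix k \<alpha>)"
    "q k \<in> counted (pat_prefix k \<alpha>) (ext_type \<alpha> (Suc k)) (item \<alpha> (Suc k)) (project (pat_prefix k \<alpha>) S)"
    if "k < Suc n" for k
  proof -
    obtain l i where li: "positions \<alpha> ! k = (l, i)" by fastforce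
    have k: "k < pat_length \<alpha>" using that assms by simp
    note pp = positions_pat_prefix[OF assms(3) k li]
    then have "finite (\<alpha> ! l)" using assms(3) by simp
    with pp show "contains S (pat_prefix k \<alpha>)"
      "q k \<in> counted (pat_prefix k \<alpha>) (ext_type \<alpha> (Suc k)) (item \<alpha> (Suc k)) (project (pat_prefix k \<alpha>) S)"
      using matched_item_counted[OF js, of l i] ext_type_positions[OF assms(3) k li]
        item_positions[OF k] li
      by (simp_all add: q_def)
  qed
  then show "contains S \<beta>" by (simp add: \<beta>_def)
  have q_nonneg: "0 \<le> q k" if "k < Suc n" for k
    using counted_nonneg[OF assms(1,2)] step[OF that] by blast
  have "occ_prob \<alpha> S js = prod_list (map (\<lambda>(l, i). the ((S ! (js ! l)) i)) (positions \<alpha>))"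
    unfolding occ_prob_def using assms(3) by (intro prod_list_positions) simp
  also have "\<dots> = (\<Prod>k<Suc n. q k)"
    by (simp add: prod.list_conv_set_nth length_positions assms(4) q_def atLeast0LessThan
        del: prod.lessThan_Suc)
  also have "\<dots> = (\<Prod>k<n. q k) * q n" by simp
  also have "\<dots> \<le> maxPr_prefix DB \<alpha> n *
      maxPr_suffix \<beta> (ext_type \<alpha> (Suc n)) (item \<alpha> (Suc n)) (project \<beta> S)"
  proof (rule mult_mono)
    have "maxPr_prefix DB \<alpha> n =
        (\<Prod>k<n. Phat DB (pat_prefix k \<alpha>) (ext_type \<alpha> (Suc k)) (item \<alpha> (Suc k)))"
      unfolding maxPr_prefix_def
      by (rule prod.reindex_bij_witness[of _ Suc "\<lambda>l. l - 1"]) auto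
    also have "\<dots> \<ge> (\<Prod>k<n. q k)"
      using q_nonneg step by (intro prod_mono) (auto intro!: counted_le_Phat[OF assms(2)])
    finally show "(\<Prod>k<n. q k) \<le> maxPr_prefix DB \<alpha> n" .
    show "q n \<le> maxPr_suffix \<beta> (ext_type \<alpha> (Suc n)) (item \<alpha> (Suc n)) (project \<beta> S)"
      unfolding maxPr_suffix_def \<beta>_def using step by (intro max0_ge[OF finite_counted]) simp
  qed (use q_nonneg maxPr_prefix_nonneg[OF assms(1)] in auto)
  finally show "occ_prob \<alpha> S js \<le> maxPr_prefix DB \<alpha> n *
      maxPr_suffix \<beta> (ext_type \<alpha> (Suc n)) (item \<alpha> (Suc n)) (project \<beta> S)" .
qed

lemma expSup_cap_nonneg:
  assumes "is_udb I DB"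
  shows "0 \<le> expSup_cap DB \<alpha>"
  unfolding expSup_cap_def Let_def
  by (intro mult_nonneg_nonneg sum_list_nonneg maxPr_prefix_nonneg[OF assms])
    (auto elim!: proj_db_cases intro: maxPr_suffix_nonneg[OF assms])

text \<open>An occurrence of \<alpha> yields one of \<beta>, so sequences without \<beta> contribute
  0. This matches the filter in \<open>proj_db\<close>, and the common factor \<open>c\<close> comes
  out of the sum.\<close>

lemma expSup_le_expSup_cap:
  assumes "is_udb I DB" "\<forall>X\<in>set \<alpha>. finite X \<and> X \<noteq> {}" "pat_length \<alpha> \<ge> 1"
  shows "expSup DB \<alpha> \<le> expSup_cap DB \<alpha>"
proof -
  obtain n where n: "pat_length \<alpha> = Suc n"
    using assms(3) by (cases "pat_length \<alpha>") auto
  define \<beta> where "\<beta> = pat_prefix n \<alpha>"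
  define c where "c = maxPr_prefix DB \<alpha> n"
  define g where "g S = maxPr_suffix \<beta> (ext_type \<alpha> (Suc n)) (item \<alpha> (Suc n)) (project \<beta> S)" for S
  have c: "0 \<le> c"
    unfolding c_def by (rule maxPr_prefix_nonneg[OF assms(1)])
  have bound: "maxPr_seq S \<alpha> \<le> (if contains S \<beta> then c * g S else 0)" if "S \<in> set DB" for S
    unfolding maxPr_seq_def
  proof (rule max0_le)
    fix p assume "p \<in> occ_prob \<alpha> S ` occurrences \<alpha> S"
    then obtain js where js: "js \<in> occurrences \<alpha> S" "p = occ_prob \<alpha> S js" by blast
    then show "p \<le> (if contains S \<beta> then c * g S else 0)"
      using occ_prob_le[OF assms(1) that assms(2) n js(1)] by (simp add: \<beta>_def c_def g_def)
  \<comment> \<open>The bound must be nonnegative as well, because \<open>max0\<close> is 0 when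
    \<alpha> does not occur in \<open>S\<close>.\<close>
  qed (use c maxPr_suffix_nonneg[OF assms(1) that] in \<open>auto simp: finite_occurrences g_def\<close>)
  have "expSup DB \<alpha> \<le> (\<Sum>S\<leftarrow>DB. if contains S \<beta> then c * g S else 0)"
    unfolding expSup_def using bound by (rule sum_list_mono)
  also have "\<dots> = c * (\<Sum>S\<leftarrow>filter (\<lambda>S. contains S \<beta>) DB. g S)"
    by (induction DB) (auto simp: distrib_left)
  also have "\<dots> = expSup_cap DB \<alpha>"
    by (simp add: expSup_cap_def Let_def n proj_db_def \<beta>_def c_def g_def comp_def)
  finally show ?thesis .
qed

section \<open>Comparison of weights\<close>

text \<open>Weights are constrained only on \<open>I\<close>, so the sign of \<open>sWeight\<close>
  depends on every item coming from an event of \<alpha>.\<close>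

lemma item_in_pattern:
  assumes "\<forall>X\<in>set \<alpha>. finite X \<and> X \<noteq> {}" "k \<in> {1..pat_length \<alpha>}"
  shows "item \<alpha> k \<in> \<Union> (set \<alpha>)"
proof -
  obtain k' where k': "k = Suc k'" "k' < pat_length \<alpha>"
    using assms(2) by (cases k) auto
  obtain l i where li: "positions \<alpha> ! k' = (l, i)" by fastforce
  show ?thesis
    using positions_pat_prefix[OF assms(1) k'(2) li] item_positions[OF k'(2)] li k'(1) by force
qed

lemma sWeight_le_mxW_s:
  assumes "pat_length \<alpha> \<ge> 1"
  shows "sWeight w \<alpha> \<le> mxW_s w \<alpha>"
proof -
  have "(\<Sum>k=1..pat_length \<alpha>. w (item \<alpha> k)) \<le> of_nat (card {1..pat_length \<alpha>}) * mxW_s w \<alpha>"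
    by (rule sum_bounded_above) (auto simp: mxW_s_def)
  then show ?thesis
    using assms by (simp add: sWeight_def divide_le_eq mult.commute)
qed

theorem lemma4:
  fixes I :: "('i::linorder) set" and w :: "'i \<Rightarrow> real"
    and DB :: "'i udb" and \<alpha> :: "'i pattern"
  assumes "finite I"
    and "\<And>i. i \<in> I \<Longrightarrow> 0 \<le> w i \<and> w i \<le> 1"
    and "is_udb I DB"
    and "is_pattern I \<alpha>"
    and "pat_length \<alpha> \<ge> 1"
  shows "wExpSup_cap w DB \<alpha> \<ge> WES w DB \<alpha>"
proof -
  have \<alpha>: "\<forall>X\<in>set \<alpha>. finite X \<and> X \<noteq> {}" "\<Union> (set \<alpha>) \<subseteq> I"
    using assms(1,4) by (auto simp: is_pattern_def intro: finite_subset)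
  \<comment> \<open>Multiplying the two inequalities requires this sign and that of
    \<open>expSup_cap\<close>.\<close>
  have "0 \<le> sWeight w \<alpha>"
    unfolding sWeight_def
    using item_in_pattern[OF \<alpha>(1)] \<alpha>(2) assms(2)
    by (intro divide_nonneg_nonneg sum_nonneg of_nat_0_le_iff) blast
  then show ?thesis
    unfolding WES_def wExpSup_cap_def
    using expSup_le_expSup_cap[OF assms(3) \<alpha>(1) assms(5)] expSup_cap_nonneg[OF assms(3)]
      sWeight_le_mxW_s[OF assms(5), of w]
    by (intro mult_mono) (auto simp: wgt_cap_def)
qed

end
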